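(* The set of all complex numbers $z$ such that $\mathrm{C}(G;z)=0$ for some finite simple graph $G$ is dense in $\mathbb{C}$. Moreover, this remains true if $G$ is restricted to range over connected finite simple graphs.
   Context: For a finite simple undirected graph $G$ with $n$ nodes, a connected set of $G$ is a nonempty subset of nodes inducing a connected subgraph, and $c_k$ denotes the number of connected sets of $G$ of order $k$. The connected set polynomial of $G$ is $\mathrm{C}(G;x)=\sum_{k=1}^n c_k x^k$; its roots are the connected set roots of $G$. *)

theory Defs
  imports
    "HOL-Analysis.Analysis"
    "HOL-Computational_Algebra.Polynomial"
    "Graph_Theory.Graph_Theory"
begin

text \<open>
  A finite simple undirected graph is a \<^const>\<open>pair_graph\<close>: a finite, loop-free, symmetric set of
  arcs on a finite vertex set, each undirected edge being represented by its two orientations.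
  Vertices are taken from \<^typ>\<open>nat\<close> in the final result, which covers all finite graphs up to
  isomorphism.  The constant \<^const>\<open>Digraph_Component.connected\<close> is graph connectedness, not the
  topological notion of the same base name.
\<close>

definition connected_sets :: "'a pair_pre_digraph \<Rightarrow> 'a set set" where
  "connected_sets G =
     {S. S \<noteq> {} \<and> S \<subseteq> pverts G \<and> Digraph_Component.connected (with_proj G \<restriction> S)}"

definition num_connected_sets :: "'a pair_pre_digraph \<Rightarrow> nat \<Rightarrow> nat" where
  "num_connected_sets G k = card {S \<in> connected_sets G. card S = k}"

definition connected_set_poly :: "'a pair_pre_digraph \<Rightarrow> complex poly" where
  "connected_set_poly G =
     (\<Sum>k = 1..card (pverts G). monom (of_nat (num_connected_sets G k)) k)"

text \<open>
  The null graph is excluded: its polynomial is the zero polynomial, for which every complex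
  number would be a root.
\<close>

definition simple_graph :: "'a pair_pre_digraph \<Rightarrow> bool" where
  "simple_graph G \<longleftrightarrow> pair_graph G \<and> pverts G \<noteq> {}"

end

theory Submission
  imports Defs
begin

text \<open>
  Replacing every vertex of the cycle \<open>C\<^sub>n\<close> by a clique of order \<open>m\<close> substitutes \<open>(1 + x)\<^sup>m - 1\<close> for \<open>x\<close>
  in the connected set polynomial. Hence if \<open>- 1 - t\<close> is a root of \<open>C(C\<^sub>n; x)\<close>, then \<open>w - 1\<close> is a
  connected set root for every \<open>w\<close> with \<open>w\<^sup>m = - t\<close>. For odd \<open>n \<ge> 5\<close> the intermediate value theorem
  yields two such \<open>t\<close>, one in \<open>[n - 3, n - 2]\<close> and one of order \<open>1 / n\<^sup>2\<close>. So for every \<open>r > 0\<close> with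
  \<open>r \<noteq> 1\<close> a suitable choice of \<open>n\<close> makes \<open>t\<close> agree with \<open>r\<^sup>m\<close> up to a bounded factor. As \<open>m\<close> grows,
  the modulus of \<open>w\<close> tends to \<open>r\<close>, while the arguments of the \<open>m\<close>-th roots of \<open>- t\<close> become dense.
\<close>

section \<open>Connected sets and generating functions by order\<close>

text \<open>Grouping the sets by order recovers the coefficients. Connected sets are nonempty
  subsets of a finite vertex set, so their orders lie in the summation range.\<close>

lemma poly_connected_set_poly:
  assumes "finite (pverts G)"
  shows "poly (connected_set_poly G) z = (\<Sum>S\<in>connected_sets G. z ^ card S)"
proof -
  have fin: "finite (connected_sets G)"
    using assms by (auto intro: finite_subset[of _ "Pow (pverts G)"] simp: connected_sets_def)
  have card: "card ` connected_sets G \<subseteq> {1..card (pverts G)}"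
  proof
    fix k assume "k \<in> card ` connected_sets G"
    then obtain S where S: "k = card S" "S \<noteq> {}" "S \<subseteq> pverts G"
      by (auto simp: connected_sets_def)
    moreover have "finite S" using S(3) assms by (rule finite_subset)
    ultimately show "k \<in> {1..card (pverts G)}"
      using assms by (simp add: Suc_le_eq card_gt_0_iff card_mono)
  qed
  have "poly (connected_set_poly G) z =
      (\<Sum>k = 1..card (pverts G). of_nat (card {S \<in> connected_sets G. card S = k}) * z ^ k)"
    by (simp add: connected_set_poly_def num_connected_sets_def poly_sum poly_monom)
  also have "\<dots> = (\<Sum>k = 1..card (pverts G). \<Sum>S \<in> {S \<in> connected_sets G. card S = k}. z ^ card S)"
    by simp
  also have "\<dots> = (\<Sum>S\<in>connected_sets G. z ^ card S)"
    by (rule sum.group[OF fin _ card]) simp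
  finally show ?thesis .
qed

text \<open>Library connectedness is strong connectedness of the symmetric closure. The arcs are
  symmetric already, so closing adds nothing, and \<open>rtrancl_on S\<close> itself keeps walks
  inside \<open>S\<close>.\<close>

lemma connected_induce_subgraph_iff:
  assumes "pair_graph G" "S \<noteq> {}"
  shows "Digraph_Component.connected (with_proj G \<restriction> S) \<longleftrightarrow>
    (\<forall>u\<in>S. \<forall>v\<in>S. (u, v) \<in> rtrancl_on S (parcs G))"
proof -
  interpret pair_graph G by fact
  have symG: "sym (parcs G)"
    using pair_sym_arcs by (simp add: symmetric_def)
  have arcs: "parcs (mk_symmetric (with_proj G \<restriction> S)) = parcs G \<inter> S \<times> S"
    using symG by (fastforce simp: parcs_mk_symmetric dest: symD)
  have "rtrancl_on S (parcs G \<inter> S \<times> S) = rtrancl_on S (parcs G)"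
  proof (intro equalityI subrelI)
    fix u v assume "(u, v) \<in> rtrancl_on S (parcs G)"
    then show "(u, v) \<in> rtrancl_on S (parcs G \<inter> S \<times> S)"
    proof induct
      case (step x y)
      then show ?case by (intro converse_rtrancl_on_into_rtrancl_on[of x y]) auto
    qed simp
  qed (auto elim: rtrancl_on_mono[rotated -1])
  then show ?thesis
    using assms(2)
    by (simp add: Digraph_Component.connected_def strongly_connected_def reachable_def arcs)
qed

lemma sum_pow_card_Pow:
  fixes z :: "'a :: comm_ring_1"
  assumes "finite A"
  shows "(\<Sum>B\<in>Pow A. z ^ card B) = (1 + z) ^ card A"
  using prod_add[OF assms, of "\<lambda>_. z" "\<lambda>_. 1"] by (simp add: add.commute[of z])

text \<open>A set with image \<open>T\<close> amounts to independent choices of a nonempty subset of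
  each fibre over \<open>T\<close>. By the binomial theorem a fibre of size \<open>c\<close>
  contributes \<open>(1 + z)^c - 1\<close>, the \<open>- 1\<close> removing the empty
  choice.\<close>

lemma sum_pow_card_image_eq:
  fixes z :: "'a :: comm_ring_1"
  assumes "finite V" "finite T"
  shows "(\<Sum>S | S \<subseteq> V \<and> f ` S = T. z ^ card S) =
    (\<Prod>t\<in>T. (1 + z) ^ card {v \<in> V. f v = t} - 1)"
  using assms(2)
proof (induction T)
  case empty
  have "{S. S \<subseteq> V \<and> f ` S = {}} = {{}}" by auto
  then show ?case by simp
next
  case (insert t T)
  define F where "F = {v \<in> V. f v = t}"
  have finF: "finite F" using assms by (simp add: F_def)
  let ?A = "Pow F - {{}}" and ?B = "{S. S \<subseteq> V \<and> f ` S = T}"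
  have "(\<Sum>S | S \<subseteq> V \<and> f ` S = insert t T. z ^ card S) =
      (\<Sum>(B, S)\<in>?A \<times> ?B. z ^ card B * z ^ card S)"
  \<comment> \<open>Splitting \<open>S\<close> into its part over \<open>t\<close> and the rest
    separates the new factor; the split is unique because \<open>t\<close> is not in
    \<open>T\<close>.\<close>
  proof (rule sum.reindex_bij_witness[of _ "\<lambda>(B, S). B \<union> S" "\<lambda>S. (S \<inter> F, S - F)"])
    fix S assume S: "S \<in> {S. S \<subseteq> V \<and> f ` S = insert t T}"
    then show "(case (S \<inter> F, S - F) of (B, S) \<Rightarrow> B \<union> S) = S" by auto
    show "(S \<inter> F, S - F) \<in> ?A \<times> ?B"
    proof -
      have "t \<in> f ` S" using S by simp
      then obtain v where "v \<in> S" "f v = t" by auto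
      then have "v \<in> S \<inter> F" using S by (auto simp: F_def)
      moreover have "f ` (S - F) = f ` S - {t}" using S by (auto simp: F_def)
      ultimately show ?thesis using S insert(2) by auto
    qed
    have "finite S" using S assms(1) finite_subset by blast
    then have "card S = card (S \<inter> F) + card (S - F)"
      by (metis Int_Diff_Un Int_Diff_disjoint card_Un_disjoint finite_Diff finite_Int)
    then show "(case (S \<inter> F, S - F) of (B, S) \<Rightarrow> z ^ card B * z ^ card S) = z ^ card S"
      by (simp add: power_add)
  next
    fix p assume p: "p \<in> ?A \<times> ?B"
    then obtain B S where BS: "p = (B, S)" "B \<subseteq> F" "B \<noteq> {}" "S \<subseteq> V" "f ` S = T" by auto
    then have "f ` B = {t}" by (auto simp: F_def)
    then have "f ` (B \<union> S) = insert t T" using BS by (simp add: image_Un)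
    then show "(case p of (B, S) \<Rightarrow> B \<union> S) \<in> {S. S \<subseteq> V \<and> f ` S = insert t T}"
      using BS by (auto simp: F_def)
    have "S \<inter> F = {}" using BS insert(2) by (auto simp: F_def)
    then show "(\<lambda>S. (S \<inter> F, S - F)) (case p of (B, S) \<Rightarrow> B \<union> S) = p"
      using BS by auto
  qed
  also have "\<dots> = (\<Sum>B\<in>?A. z ^ card B) * (\<Sum>S\<in>?B. z ^ card S)"
    by (simp add: sum_product sum.cartesian_product)
  also have "(\<Sum>B\<in>?A. z ^ card B) = (1 + z) ^ card F - 1"
    using finF by (simp add: sum_diff1 sum_pow_card_Pow)
  finally show ?case
    using insert by (simp add: F_def)
qed

section \<open>Connected sets of blown-up cycles\<close>

text \<open>
  The \<open>n\<close>-cycle with every vertex replaced by a clique of order \<open>m\<close>; the vertex \<open>v\<close> belongs to the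
  clique at position \<open>v mod n\<close>.
\<close>

definition cycle_blowup :: "nat \<Rightarrow> nat \<Rightarrow> nat pair_pre_digraph" where
  "cycle_blowup n m = \<lparr>pverts = {..<n * m},
     parcs = {(u, v). u < n * m \<and> v < n * m \<and> u \<noteq> v \<and>
       (u mod n = v mod n \<or> Suc u mod n = v mod n \<or> Suc v mod n = u mod n)}\<rparr>"

definition cyclic_interval :: "nat \<Rightarrow> nat \<Rightarrow> nat \<Rightarrow> nat set" where
  "cyclic_interval n i k = (\<lambda>j. (i + j) mod n) ` {..<k}"

lemma pverts_cycle_blowup [simp]: "pverts (cycle_blowup n m) = {..<n * m}"
  by (simp add: cycle_blowup_def)

lemma pair_graph_cycle_blowup: "pair_graph (cycle_blowup n m)"
proof
  show "finite (parcs (cycle_blowup n m))"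
    by (rule finite_subset[of _ "{..<n * m} \<times> {..<n * m}"]) (auto simp: cycle_blowup_def)
  show "symmetric (with_proj (cycle_blowup n m))"
    by (auto simp: symmetric_def sym_def cycle_blowup_def)
qed (auto simp: cycle_blowup_def)

lemma Suc_mod_eq_cancel:
  fixes a b n :: nat
  assumes "Suc a mod n = Suc b mod n"
  shows "a mod n = b mod n"
proof (cases "n = 0")
  case False
  \<comment> \<open>Advancing by \<open>n - 1\<close> more completes a full turn and so undoes the
    successor.\<close>
  have "(Suc a + (n - 1)) mod n = (Suc b + (n - 1)) mod n"
    using assms by (metis mod_add_left_eq)
  then show ?thesis using False by simp
qed (use assms in simp)

lemma card_cyclic_interval:
  assumes "k \<le> n"
  shows "card (cyclic_interval n i k) = k"
proof -
  have "j = j'" if "j < k" "j' < k" "(i + j) mod n = (i + j') mod n" for j j'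
    using that
  proof (induction i)
    case 0
    then show ?case using assms by simp
  next
    case (Suc i)
    then show ?case using Suc_mod_eq_cancel[of "i + j" n "i + j'"] by simp
  qed
  then show ?thesis
    by (simp add: cyclic_interval_def card_image inj_on_def)
qed

text \<open>The start of a proper arc is its only element whose predecessor lies outside. If the
  predecessor of \<open>i\<close> were \<open>i + l\<close> with \<open>l < k\<close>, then
  \<open>l + 1 < n\<close> steps would lead from \<open>i\<close> back to \<open>i\<close>.\<close>

lemma cyclic_interval_start_unique:
  assumes "k < n" "i < n" "i' < n" "cyclic_interval n i k = cyclic_interval n i' k" "0 < k"
  shows "i = i'"
proof (rule ccontr)
  assume ne: "i \<noteq> i'"
  have "i \<in> cyclic_interval n i' k"
    using assms by (force simp: cyclic_interval_def)
  then obtain j where j: "j < k" "i = (i' + j) mod n"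
    by (auto simp: cyclic_interval_def)
  have "j > 0" using j ne assms(3) by (cases "j = 0") auto
  then have pred: "(i' + (j - 1)) mod n \<in> cyclic_interval n i k"
    unfolding assms(4) unfolding cyclic_interval_def using j(1) by (intro imageI) simp
  then obtain l where l: "l < k" "(i + l) mod n = (i' + (j - 1)) mod n"
    by (auto simp: cyclic_interval_def)
  have "(i + Suc l) mod n = (i' + j) mod n"
    using l(2) \<open>j > 0\<close> by (metis Suc_diff_1 add_Suc_right mod_Suc_eq)
  then have "(i + Suc l) mod n = (i + 0) mod n"
    using j assms(2) by simp
  moreover have "inj_on (\<lambda>j. (i + j) mod n) {..<n}"
    using card_cyclic_interval[of n n i] by (simp add: cyclic_interval_def eq_card_imp_inj_on)
  ultimately show False
    using l(1) assms(1) inj_onD[of "\<lambda>j. (i + j) mod n" "{..<n}" "Suc l" 0] by simp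
qed

lemma mod_range_induct:
  fixes n :: nat
  assumes "i \<in> T" "i < n" "\<And>i. i \<in> T \<Longrightarrow> Suc i mod n \<in> T"
  shows "{..<n} \<subseteq> T"
proof
  fix j assume "j \<in> {..<n}"
  have "(i + k) mod n \<in> T" for k
  proof (induction k)
    case (Suc k)
    then show ?case using assms(3)[OF Suc] by (simp add: mod_Suc_eq)
  qed (use assms in simp)
  from this[of "n - i + j"] show "j \<in> T"
    using assms(2) \<open>j \<in> {..<n}\<close> by simp
qed

text \<open>A maximal run of occupied positions has a gap at both ends. No arc inside
  \<open>S\<close> leaves such a run, so connectedness forces the run to be the whole image.\<close>

lemma mod_image_eq_cyclic_interval_if_connected:
  assumes S: "S \<subseteq> {..<n * m}" "S \<noteq> {}"
    and conn: "\<And>u v. u \<in> S \<Longrightarrow> v \<in> S \<Longrightarrow> (u, v) \<in> rtrancl_on S (parcs (cycle_blowup n m))"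
    and proper: "(\<lambda>v. v mod n) ` S \<noteq> {..<n}"
  shows "\<exists>i<n. \<exists>k\<in>{1..<n}. (\<lambda>v. v mod n) ` S = cyclic_interval n i k"
proof -
  define T where "T = (\<lambda>v. v mod n) ` S"
  have n: "n > 0" using S by (cases "n = 0") auto
  have T: "T \<subseteq> {..<n}" "T \<noteq> {}" using S n by (auto simp: T_def)
  \<comment> \<open>If every gap were followed by a gap, going round the cycle would make all
    positions gaps.\<close>
  obtain p where p: "p < n" "p \<notin> T" "Suc p mod n \<in> T"
  proof -
    obtain q where "q \<in> {..<n} - T" using T proper by (auto simp: T_def)
    moreover have "\<not> {..<n} \<subseteq> {..<n} - T" using T by auto
    ultimately have "\<not> (\<forall>i\<in>{..<n} - T. Suc i mod n \<in> {..<n} - T)"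
      using mod_range_induct[of q "{..<n} - T" n] by auto
    then show ?thesis using that n by auto
  qed
  define i where "i = Suc p mod n"
  \<comment> \<open>The run from \<open>i\<close> ends at the first gap. Since \<open>p\<close> is a
    gap at distance \<open>n - 1\<close>, the run is proper.\<close>
  define k where "k = (LEAST k. (i + k) mod n \<notin> T)"
  have last: "(i + (n - 1)) mod n = p"
  proof -
    have "(i + (n - 1)) mod n = (Suc p + (n - 1)) mod n"
      unfolding i_def by (rule mod_add_left_eq)
    then show ?thesis using p n by simp
  qed
  then have ex: "(i + (n - 1)) mod n \<notin> T" using p by simp
  have kT: "(i + k) mod n \<notin> T" unfolding k_def by (rule LeastI, rule ex)
  have kn: "k \<le> n - 1" unfolding k_def by (rule Least_le, rule ex)
  have less: "(i + j) mod n \<in> T" if "j < k" for j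
    using not_less_Least that unfolding k_def by blast
  have i: "i < n" "i \<in> T" using n p by (auto simp: i_def)
  have k0: "k > 0" using kT i by (cases "k = 0") auto
  define A where "A = cyclic_interval n i k"
  have AT: "A \<subseteq> T" using less by (auto simp: A_def cyclic_interval_def)
  \<comment> \<open>Moving forward off the run would land on the gap \<open>i + k\<close>, moving
    backward on the gap \<open>p\<close>.\<close>
  have closed: "v mod n \<in> A"
    if "u \<in> S" "v \<in> S" "u mod n \<in> A" "(u, v) \<in> parcs (cycle_blowup n m)" for u v
  proof -
    from that(3) obtain j where j: "j < k" "u mod n = (i + j) mod n"
      by (auto simp: A_def cyclic_interval_def)
    have vT: "v mod n \<in> T" using that by (simp add: T_def)
    from that(4) consider "u mod n = v mod n" | "Suc u mod n = v mod n" | "Suc v mod n = u mod n"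
      by (auto simp: cycle_blowup_def)
    then show ?thesis
    proof cases
      case 1
      then show ?thesis using that by simp
    next
      case 2
      then have v: "v mod n = (i + Suc j) mod n"
        using j by (metis add_Suc_right mod_Suc_eq)
      with vT kT j have "Suc j < k" by (metis Suc_lessI)
      with v show ?thesis unfolding A_def cyclic_interval_def by blast
    next
      case 3
      show ?thesis
      proof (cases j)
        case 0
        then have "Suc v mod n = Suc p mod n" using 3 j i by (simp add: i_def)
        then have "v mod n = p" using Suc_mod_eq_cancel[of v n p] p by simp
        then show ?thesis using vT p by simp
      next
        case (Suc l)
        then have "Suc v mod n = Suc (i + l) mod n" using 3 j by simp
        then have "v mod n = (i + l) mod n" by (rule Suc_mod_eq_cancel)
        then show ?thesis using j Suc by (auto simp: A_def cyclic_interval_def)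
      qed
    qed
  qed
  have "i \<in> A" using k0 i by (force simp: A_def cyclic_interval_def)
  then obtain u where u: "u \<in> S" "u mod n = i" using AT by (auto simp: T_def)
  have "v mod n \<in> A" if "v \<in> S" for v
    using conn[OF u(1) that]
  proof (induct rule: rtrancl_on_induct)
    case base
    then show ?case using u \<open>i \<in> A\<close> by simp
  next
    case (step y z)
    then show ?case using closed[of y z] by simp
  qed
  then have "T = A" using AT by (auto simp: T_def)
  moreover have "k \<in> {1..<n}" using k0 kn n by auto
  ultimately show ?thesis using i unfolding A_def T_def by blast
qed

text \<open>Starting from a representative of the first position, a walk along chosen
  representatives reaches every position of the arc. Vertices in equal or consecutive positions are
  equal or adjacent, so it can end at any vertex of \<open>S\<close>; symmetry joins two such
  walks.\<close>

lemma connected_if_mod_image_eq_cyclic_interval: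
  assumes S: "S \<subseteq> {..<n * m}" and im: "(\<lambda>v. v mod n) ` S = cyclic_interval n i k"
    and uv: "u \<in> S" "v \<in> S"
  shows "(u, v) \<in> rtrancl_on S (parcs (cycle_blowup n m))" (is "_ \<in> ?R")
proof -
  have rep: "\<exists>x\<in>S. x mod n = (i + j) mod n" if "j < k" for j
  proof -
    have "(i + j) mod n \<in> (\<lambda>v. v mod n) ` S"
      unfolding im using that by (auto simp: cyclic_interval_def)
    then show ?thesis by auto
  qed
  have "k > 0" using im uv by (cases "k = 0") (auto simp: cyclic_interval_def)
  then obtain x where x: "x \<in> S" "x mod n = i mod n" using rep[of 0] by auto
  have adj: "(a, b) \<in> ?R" if "a \<in> S" "b \<in> S" "a mod n = b mod n \<or> Suc a mod n = b mod n" for a b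
  proof (cases "a = b")
    case False
    then have "(a, b) \<in> parcs (cycle_blowup n m)" using that S by (auto simp: cycle_blowup_def)
    then show ?thesis using that by (auto intro: rtrancl_on_into_rtrancl_on)
  qed (use that in auto)
  have reach: "(x, y) \<in> ?R" if "y \<in> S" "y mod n = (i + j) mod n" "j < k" for y j
    using that
  proof (induction j arbitrary: y)
    case 0
    then show ?case using adj x by simp
  next
    case (Suc j)
    obtain a where a: "a \<in> S" "a mod n = (i + j) mod n" using rep[of j] Suc by auto
    then have "Suc a mod n = y mod n" using Suc by (metis add_Suc_right mod_Suc_eq)
    then have "(a, y) \<in> ?R" using adj a Suc by blast
    moreover have "(x, a) \<in> ?R" using Suc a by simp
    ultimately show ?case using rtrancl_on_trans by metis
  qed
  have all: "(x, y) \<in> ?R" if "y \<in> S" for y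
  proof -
    have "y mod n \<in> cyclic_interval n i k" using im that by blast
    then show ?thesis using reach that by (auto simp: cyclic_interval_def)
  qed
  have "sym ?R"
    by (rule rtrancl_on_sym) (auto simp: sym_def cycle_blowup_def)
  then show ?thesis using all uv by (meson rtrancl_on_trans symD)
qed

lemma cyclic_interval_full:
  assumes "n > 0"
  shows "cyclic_interval n 0 n = {..<n}"
  using assms by (auto simp: cyclic_interval_def)

text \<open>
  Start and length of the connected subsets of an \<open>n\<close>-cycle. The whole cycle would arise from every
  start, so it is listed once.
\<close>

definition arc_params :: "nat \<Rightarrow> (nat \<times> nat) set" where
  "arc_params n = insert (0, n) ({..<n} \<times> {1..<n})"

lemma connected_sets_cycle_blowup:
  assumes "n > 0"
  shows "connected_sets (cycle_blowup n m) =
    (\<Union>(i, k)\<in>arc_params n. {S. S \<subseteq> {..<n * m} \<and> (\<lambda>v. v mod n) ` S = cyclic_interval n i k})"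
    (is "?L = ?R")
proof (intro equalityI subsetI)
  fix S assume "S \<in> ?L"
  then have S: "S \<noteq> {}" "S \<subseteq> {..<n * m}"
    and conn: "\<And>u v. u \<in> S \<Longrightarrow> v \<in> S \<Longrightarrow> (u, v) \<in> rtrancl_on S (parcs (cycle_blowup n m))"
    using connected_induce_subgraph_iff[OF pair_graph_cycle_blowup, of S n m]
    by (auto simp: connected_sets_def)
  show "S \<in> ?R"
  proof (cases "(\<lambda>v. v mod n) ` S = {..<n}")
    case True
    then show ?thesis using S cyclic_interval_full[OF assms] by (auto simp: arc_params_def)
  next
    case False
    from mod_image_eq_cyclic_interval_if_connected[OF S(2,1) conn this]
    obtain i k where "i < n" "k \<in> {1..<n}" "(\<lambda>v. v mod n) ` S = cyclic_interval n i k"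
      by blast
    moreover from this have "(i, k) \<in> arc_params n" by (simp add: arc_params_def)
    ultimately show ?thesis using S by blast
  qed
next
  fix S assume "S \<in> ?R"
  then obtain i k where ik: "(i, k) \<in> arc_params n" "S \<subseteq> {..<n * m}"
    "(\<lambda>v. v mod n) ` S = cyclic_interval n i k" by auto
  have "k > 0" using ik assms by (auto simp: arc_params_def)
  then have "S \<noteq> {}" using ik by (auto simp: cyclic_interval_def)
  then show "S \<in> ?L"
    using ik(2) connected_if_mod_image_eq_cyclic_interval[OF ik(2,3)]
    by (simp add: connected_sets_def connected_induce_subgraph_iff[OF pair_graph_cycle_blowup])
qed

text \<open>This makes the union over \<open>arc_params\<close> disjoint. Cardinality recovers the
  length; the start is then determined by the arc if it is proper, and is 0 for the full
  cycle.\<close>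

lemma inj_on_cyclic_interval: "inj_on (\<lambda>(i, k). cyclic_interval n i k) (arc_params n)"
proof (rule inj_onI, clarsimp)
  fix i k i' k'
  assume a: "(i, k) \<in> arc_params n" "(i', k') \<in> arc_params n"
    "cyclic_interval n i k = cyclic_interval n i' k'"
  have "k = k'"
    using a card_cyclic_interval[of k n i] card_cyclic_interval[of k' n i']
    by (auto simp: arc_params_def)
  then show "i = i' \<and> k = k'"
    using a cyclic_interval_start_unique[of k n i i'] by (auto simp: arc_params_def)
qed

lemma card_mod_fibre:
  fixes n m t :: nat
  assumes "t < n"
  shows "card {v \<in> {..<n * m}. v mod n = t} = m"
proof -
  have "{v \<in> {..<n * m}. v mod n = t} = (\<lambda>q. q * n + t) ` {..<m}"
  proof (intro equalityI subsetI)
    fix v assume v: "v \<in> {v \<in> {..<n * m}. v mod n = t}"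
    then have "v div n < m" by (simp add: less_mult_imp_div_less mult.commute)
    moreover have "v = v div n * n + t" using v by (metis (lifting) div_mult_mod_eq mem_Collect_eq)
    ultimately show "v \<in> (\<lambda>q. q * n + t) ` {..<m}" by blast
  next
    fix v assume "v \<in> (\<lambda>q. q * n + t) ` {..<m}"
    then obtain q where q: "q < m" "v = q * n + t" by auto
    have "q * n + t < Suc q * n" using assms by simp
    also have "\<dots> \<le> m * n" using q by (intro mult_le_mono1) simp
    finally show "v \<in> {v \<in> {..<n * m}. v mod n = t}" using q assms by (simp add: mult.commute)
  qed
  moreover have "inj_on (\<lambda>q. q * n + t) {..<m}" using assms by (auto simp: inj_on_def)
  ultimately show ?thesis by (simp add: card_image)
qed

text \<open>Each arc of length \<open>k\<close> contributes one factor \<open>(1 + z)^m - 1\<close>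
  per position. There are \<open>n\<close> arcs of each length below \<open>n\<close> and one full
  cycle.\<close>

lemma poly_connected_set_poly_cycle_blowup:
  assumes "n > 0"
  shows "poly (connected_set_poly (cycle_blowup n m)) z =
    ((1 + z) ^ m - 1) ^ n + of_nat n * (\<Sum>k = 1..<n. ((1 + z) ^ m - 1) ^ k)"
proof -
  let ?C = "\<lambda>(i, k). {S. S \<subseteq> {..<n * m} \<and> (\<lambda>v. v mod n) ` S = cyclic_interval n i k}"
  let ?w = "(1 + z) ^ m - 1"
  have fin: "finite (arc_params n)" by (simp add: arc_params_def)
  have "poly (connected_set_poly (cycle_blowup n m)) z =
      (\<Sum>S\<in>(\<Union>p\<in>arc_params n. ?C p). z ^ card S)"
    by (subst poly_connected_set_poly)
      (simp_all add: connected_sets_cycle_blowup[OF assms])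
  also have "\<dots> = (\<Sum>p\<in>arc_params n. \<Sum>S\<in>?C p. z ^ card S)"
  proof (rule sum.UNION_disjoint[OF fin])
    show "\<forall>p\<in>arc_params n. finite (?C p)" by auto
    show "\<forall>p\<in>arc_params n. \<forall>q\<in>arc_params n. p \<noteq> q \<longrightarrow> ?C p \<inter> ?C q = {}"
      using inj_on_cyclic_interval[of n] by (fastforce simp: inj_on_def)
  qed
  also have "\<dots> = (\<Sum>(i, k)\<in>arc_params n. ?w ^ k)"
  proof (rule sum.cong[OF refl])
    fix p assume "p \<in> arc_params n"
    then obtain i k where p: "p = (i, k)" and ik: "(i, k) \<in> arc_params n"
      by (cases p) auto
    have "(\<Sum>S\<in>?C (i, k). z ^ card S) =
        (\<Prod>t\<in>cyclic_interval n i k. (1 + z) ^ card {v \<in> {..<n * m}. v mod n = t} - 1)"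
      unfolding prod.case
      by (rule sum_pow_card_image_eq) (simp_all add: cyclic_interval_def)
    also have "\<dots> = (\<Prod>t\<in>cyclic_interval n i k. ?w)"
      by (rule prod.cong[OF refl], subst card_mod_fibre)
        (use assms in \<open>auto simp: cyclic_interval_def\<close>)
    also have "\<dots> = ?w ^ k"
      using ik by (subst prod_constant, subst card_cyclic_interval) (auto simp: arc_params_def)
    finally show "(\<Sum>S\<in>?C p. z ^ card S) = (case p of (i, k) \<Rightarrow> ?w ^ k)"
      by (simp add: p)
  qed
  also have "\<dots> = ?w ^ n + (\<Sum>i<n. \<Sum>k = 1..<n. ?w ^ k)"
    unfolding sum.cartesian_product by (simp add: arc_params_def)
  finally show ?thesis by simp
qed

text \<open>The full vertex set projects onto the full cycle, so it is itself a connected set, and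
  restricting to it changes nothing.\<close>

lemma connected_cycle_blowup:
  assumes "n > 0" "m > 0"
  shows "Digraph_Component.connected (with_proj (cycle_blowup n m))"
proof -
  let ?G = "cycle_blowup n m"
  have "(\<lambda>v. v mod n) ` {..<n * m} = cyclic_interval n 0 n"
  proof -
    have "t \<in> (\<lambda>v. v mod n) ` {..<n * m}" if "t < n" for t
      using that assms by (intro image_eqI[of _ _ t]) (auto intro: less_le_trans)
    then show ?thesis using assms by (auto simp: cyclic_interval_full)
  qed
  then have "{..<n * m} \<in> connected_sets ?G"
    using assms by (auto simp: connected_sets_cycle_blowup arc_params_def)
  moreover have "with_proj ?G \<restriction> {..<n * m} = with_proj ?G"
    by (auto simp: induce_subgraph_def with_proj_def cycle_blowup_def)
  ultimately show ?thesis by (simp add: connected_sets_def)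
qed

section \<open>Real roots of the cycle polynomial\<close>

text \<open>
  Summing the geometric series at \<open>w = - t - 1\<close> with \<open>n\<close> odd turns \<open>(1 - w) C(C\<^sub>n; w) = 0\<close>, after
  division by \<open>w\<close>, into the equation below.
\<close>

lemma cycle_poly_root:
  fixes t :: real
  assumes "odd n" "t \<ge> 0" "(1 + t) ^ (n - 1) * (real n - 2 - t) = real n"
  defines "w \<equiv> - complex_of_real t - 1"
  shows "w ^ n + of_nat n * (\<Sum>k = 1..<n. w ^ k) = 0"
proof -
  define x where "x = - t - 1"
  have n: "n > 0" using assms(1) by (simp add: odd_pos)
  have geom: "(1 - x) * (\<Sum>k = 1..<n. x ^ k) = x - x ^ n"
  proof -
    have "(1 - x) * (\<Sum>k<n. x ^ k) = 1 - x ^ n"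
      by (simp add: one_diff_power_eq)
    moreover have "(\<Sum>k<n. x ^ k) = 1 + (\<Sum>k = 1..<n. x ^ k)"
      using n by (simp add: lessThan_atLeast0 sum.atLeast_Suc_lessThan)
    ultimately show ?thesis by (simp add: algebra_simps)
  qed
  \<comment> \<open>As \<open>n - 1\<close> is even, the sign of \<open>x = - (1 + t)\<close>
    survives only in the single factor split off.\<close>
  have xn: "x ^ n = x * (1 + t) ^ (n - 1)"
  proof -
    have "x ^ n = x * x ^ (n - 1)" using n by (metis power_eq_if not_gr_zero)
    also have "x ^ (n - 1) = (- x) ^ (n - 1)" using assms(1) by (simp add: power_minus_even)
    finally show ?thesis by (simp add: x_def add.commute)
  qed
  have "(1 - x) * (x ^ n + real n * (\<Sum>k = 1..<n. x ^ k)) =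
      (1 - x) * x ^ n + real n * (x - x ^ n)"
    by (simp add: algebra_simps flip: geom)
  also have "\<dots> = x * (real n - (1 + t) ^ (n - 1) * (real n - 2 - t))"
    unfolding xn by (simp add: x_def algebra_simps)
  also have "\<dots> = 0" using assms(3) by simp
  \<comment> \<open>The factor \<open>1 - x = 2 + t\<close> is positive and cancels.\<close>
  finally have "x ^ n + real n * (\<Sum>k = 1..<n. x ^ k) = 0"
    using assms(2) by (simp add: x_def)
  then have "complex_of_real (x ^ n + real n * (\<Sum>k = 1..<n. x ^ k)) = 0" by simp
  then show ?thesis by (simp add: x_def w_def)
qed

text \<open>The left side vanishes at \<open>t = n - 2\<close> and equals
  \<open>(n - 2)^(n - 1)\<close>, which is at least \<open>n\<close>, at
  \<open>t = n - 3\<close>.\<close>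

lemma cycle_root_large:
  fixes n :: nat
  assumes "n \<ge> 5"
  shows "\<exists>t::real. real n - 3 \<le> t \<and> t \<le> real n - 2 \<and>
    (1 + t) ^ (n - 1) * (real n - 2 - t) = real n"
proof -
  have "real n \<le> (real n - 2) ^ 2"
    using assms mult_mono[of 3 "real n - 2" "real n - 2" "real n - 2"]
    by (simp add: power2_eq_square)
  also have "\<dots> \<le> (real n - 2) ^ (n - 1)"
    using assms by (intro power_increasing) auto
  finally show ?thesis
    by (intro IVT2) (auto intro!: continuous_intros)
qed

text \<open>To first order in \<open>t\<close> the left side is about
  \<open>n - 2 + n^2 * t\<close>, so a root is expected near \<open>2 / n^2\<close>. The two
  endpoints bracket this value.\<close>

lemma cycle_root_small:
  fixes n :: nat
  assumes "n \<ge> 5"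
  shows "\<exists>t::real. 1 / real n ^ 2 \<le> t \<and> t \<le> 4 / (real n - 2) ^ 2 \<and>
    (1 + t) ^ (n - 1) * (real n - 2 - t) = real n"
proof (rule IVT)
  let ?a = "1 / real n ^ 2" and ?b = "4 / (real n - 2) ^ 2"
  have n: "real n \<ge> 5" using assms by simp
  have a: "0 \<le> ?a" "?a \<le> 1"
    using n by (simp_all add: divide_le_eq_1 one_le_power)
  then have ab: "real n - 2 - ?a \<le> real n - 1" "0 \<le> real n - 2 - ?a"
    using n by linarith+
  \<comment> \<open>The exponential bounds the power by \<open>n / (n - 1)\<close>, which exactly
    offsets the bound \<open>n - 1\<close> on the other factor.\<close>
  have "(1 + ?a) ^ (n - 1) \<le> exp ?a ^ (n - 1)"
    by (intro power_mono exp_ge_add_one_self) auto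
  also have "\<dots> = exp (real (n - 1) * ?a)" by (simp only: exp_of_nat_mult)
  also have "\<dots> \<le> exp (1 / real n)"
    using n by (simp add: power2_eq_square field_simps)
  also have "\<dots> = 1 / exp (- (1 / real n))" by (simp add: exp_minus field_simps)
  also have "\<dots> \<le> 1 / (1 - 1 / real n)"
    using n exp_ge_add_one_self[of "- (1 / real n)"] by (intro divide_left_mono) (auto simp: field_simps)
  finally have "(1 + ?a) ^ (n - 1) * (real n - 2 - ?a) \<le> 1 / (1 - 1 / real n) * (real n - 1)"
    using n ab by (intro mult_mono) simp_all
  also have "\<dots> = real n" using n by (simp add: field_simps)
  finally show "(1 + ?a) ^ (n - 1) * (real n - 2 - ?a) \<le> real n" .
  define s where "s = real n - 2"
  have s: "s \<ge> 3" using n by (simp add: s_def)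
  \<comment> \<open>This is the target after Bernoulli's inequality, with \<open>n = s + 2\<close>.
    Clearing denominators leaves a quartic inequality, linear once the powers of \<open>s\<close>
    are treated as separate quantities.\<close>
  have "s + 2 \<le> (1 + (s + 1) * (4 / s ^ 2)) * (s - 4 / s ^ 2)"
  proof -
    have lin: "2 * c + 4 * b \<ge> 4 * a + 16 * (s + 1)" if "a \<ge> 3 * s" "b \<ge> 3 * a" "c \<ge> 3 * b" for a b c
      using that s by simp
    have "s ^ 2 \<ge> 3 * s" "s ^ 3 \<ge> 3 * s ^ 2" "s ^ 4 \<ge> 3 * s ^ 3"
      using s by (auto simp: power2_eq_square power3_eq_cube power4_eq_xxxx)
    then have "2 * s ^ 4 + 4 * s ^ 3 \<ge> 4 * s ^ 2 + 16 * (s + 1)"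
      using lin by blast
    then show ?thesis using s
      by (simp add: field_simps power2_eq_square power3_eq_cube power4_eq_xxxx)
  qed
  also have "\<dots> \<le> (1 + 4 / s ^ 2) ^ (n - 1) * (s - 4 / s ^ 2)"
  proof (rule mult_right_mono)
    have "1 + real (n - 1) * (4 / s ^ 2) \<le> (1 + 4 / s ^ 2) ^ (n - 1)"
      by (rule Bernoulli_inequality) (auto intro: order_trans[of _ 0])
    then show "1 + (s + 1) * (4 / s ^ 2) \<le> (1 + 4 / s ^ 2) ^ (n - 1)"
      using n by (simp add: s_def of_nat_diff)
    have "4 \<le> s ^ 3" using s power_mono[of 3 s 3] by simp
    then show "0 \<le> s - 4 / s ^ 2"
      using s by (simp add: field_simps power2_eq_square power3_eq_cube)
  qed
  finally show "real n \<le> (1 + ?b) ^ (n - 1) * (real n - 2 - ?b)" by (simp add: s_def)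
  have "(real n - 2) ^ 2 \<le> real n ^ 2" using n by (intro power_mono) auto
  then show "?a \<le> ?b" using n by (intro frac_le) auto
qed (auto intro!: continuous_intros)

lemma odd_nat_comparable:
  fixes x :: real
  assumes "x \<ge> 1"
  shows "\<exists>n. odd n \<and> n \<ge> 5 \<and> x \<le> real n - 3 \<and> real n \<le> 5 * x"
proof -
  define k where "k = nat \<lfloor>x\<rfloor>"
  have k: "real k \<le> x" "x < real k + 1" "k \<ge> 1"
    using assms unfolding k_def by linarith+
  then have "real k \<ge> 1" by simp
  \<comment> \<open>From \<open>k >= 1\<close> follow \<open>2 * k >= k + 1 > x\<close> and
    \<open>2 * k + 3 <= 5 * k <= 5 * x\<close>.\<close>
  with k show ?thesis by (intro exI[of _ "2 * k + 3"]) auto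
qed

text \<open>For \<open>r > 1\<close> the large root has order \<open>n\<close>, so \<open>n\<close>
  is taken comparable to \<open>r^m\<close>. Otherwise the small root has order
  \<open>1 / n^2\<close>, so \<open>n\<close> is taken comparable to \<open>R\<close>, with
  \<open>R^2 = 1 / r^m\<close>; squaring \<open>n <= 5 * R\<close> gives the constant 1/25.\<close>

lemma cycle_root_scaled:
  fixes r :: real
  assumes "r > 0" "r \<noteq> 1"
  shows "\<exists>n t. odd n \<and> (1 / 25) * r ^ m \<le> t \<and> t \<le> 5 * r ^ m \<and>
    (1 + t) ^ (n - 1) * (real n - 2 - t) = real n"
proof (cases "r > 1")
  case True
  then have r: "r ^ m \<ge> 1" by simp
  then obtain n where n: "odd n" "n \<ge> 5" "r ^ m \<le> real n - 3" "real n \<le> 5 * r ^ m"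
    using odd_nat_comparable by blast
  obtain t where "real n - 3 \<le> t" "t \<le> real n - 2"
    "(1 + t) ^ (n - 1) * (real n - 2 - t) = real n"
    using cycle_root_large[OF n(2)] by blast
  then show ?thesis
    using n r by (intro exI[of _ n] exI[of _ t]) auto
next
  case False
  define R where "R = 1 / sqrt (r ^ m)"
  have R: "R \<ge> 1" "r ^ m = 1 / R ^ 2"
    using assms False by (auto simp: R_def power_divide power_le_one)
  obtain n where n: "odd n" "n \<ge> 5" "R \<le> real n - 3" "real n \<le> 5 * R"
    using odd_nat_comparable[OF R(1)] by blast
  obtain t where t: "1 / real n ^ 2 \<le> t" "t \<le> 4 / (real n - 2) ^ 2"
    "(1 + t) ^ (n - 1) * (real n - 2 - t) = real n"
    using cycle_root_small[OF n(2)] by blast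
  have "(1 / 25) * r ^ m = 1 / (5 * R) ^ 2" by (simp add: power_mult_distrib R(2))
  also have "\<dots> \<le> 1 / real n ^ 2"
    using n R by (intro divide_left_mono power_mono) auto
  finally have 1: "(1 / 25) * r ^ m \<le> t" using t by linarith
  have "4 / (real n - 2) ^ 2 \<le> 5 / R ^ 2"
    using n R by (intro frac_le power_mono) auto
  then have "t \<le> 5 * r ^ m" using t by (simp add: R(2))
  then show ?thesis using t 1 n by blast
qed

section \<open>Limits of m-th roots\<close>

text \<open>The constant factors disappear because the \<open>m\<close>-th root of a positive
  constant tends to 1.\<close>

lemma root_tendsto_if_scaled:
  fixes t :: "nat \<Rightarrow> real"
  assumes "c > 0" "C > 0" "r > 0" and t: "\<And>m. c * r ^ m \<le> t m" "\<And>m. t m \<le> C * r ^ m"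
  shows "(\<lambda>m. root m (t m)) \<longlonglongrightarrow> r"
proof (rule tendsto_sandwich)
  show "(\<lambda>m. root m c * r) \<longlonglongrightarrow> r"
    using tendsto_mult[OF LIMSEQ_root_const[OF assms(1)] tendsto_const[of r]] by simp
  show "(\<lambda>m. root m C * r) \<longlonglongrightarrow> r"
    using tendsto_mult[OF LIMSEQ_root_const[OF assms(2)] tendsto_const[of r]] by simp
  have root: "root m (a * r ^ m) = root m a * r" if "m > 0" for m a
    using that assms(3) by (simp add: real_root_mult real_root_power_cancel)
  show "\<forall>\<^sub>F m in sequentially. root m c * r \<le> root m (t m)"
    using eventually_gt_at_top[of 0] by eventually_elim (metis root real_root_le_mono t(1))
  show "\<forall>\<^sub>F m in sequentially. root m (t m) \<le> root m C * r"
    using eventually_gt_at_top[of 0] by eventually_elim (metis root real_root_le_mono t(2))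
qed

lemma negative_roots_tendsto:
  fixes t :: "nat \<Rightarrow> real"
  assumes "\<And>m. t m \<ge> 0" "(\<lambda>m. root m (t m)) \<longlonglongrightarrow> r"
  shows "\<exists>w. (\<forall>m>0. w m ^ m = - complex_of_real (t m)) \<and> w \<longlonglongrightarrow> rcis r \<theta>"
proof -
  \<comment> \<open>For \<open>m > 0\<close> the candidate arguments
    \<open>(pi + 2 * pi * j) / m\<close> are spaced by \<open>2 * pi / m\<close>; the floor selects
    the largest one not exceeding \<theta>.\<close>
  define j where "j m = \<lfloor>(real m * \<theta> - pi) / (2 * pi)\<rfloor>" for m
  define \<phi> where "\<phi> m = (pi + 2 * pi * of_int (j m)) / real m" for m
  define w where "w m = rcis (root m (t m)) (\<phi> m)" for m
  have "w m ^ m = - complex_of_real (t m)" if "m > 0" for m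
  proof -
    have "w m ^ m = rcis (root m (t m) ^ m) (real m * \<phi> m)"
      by (simp add: w_def DeMoivre2)
    also have "real m * \<phi> m = pi + 2 * pi * of_int (j m)" using that by (simp add: \<phi>_def)
    also have "root m (t m) ^ m = t m" using that assms(1) by simp
    finally show ?thesis by (simp add: rcis_def flip: cis_mult)
  qed
  moreover have "\<phi> \<longlonglongrightarrow> \<theta>"
  proof (rule tendsto_sandwich)
    have bounds: "real m * \<theta> - 2 * pi \<le> pi + 2 * pi * of_int (j m)"
      "pi + 2 * pi * of_int (j m) \<le> real m * \<theta>" for m
    proof -
      define y where "y = (real m * \<theta> - pi) / (2 * pi)"
      have "real m * \<theta> = pi + 2 * pi * y" by (simp add: y_def)
      moreover have "2 * pi * (y - 1) \<le> 2 * pi * of_int (j m)" "2 * pi * of_int (j m) \<le> 2 * pi * y"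
        unfolding j_def y_def[symmetric] by (intro mult_left_mono; (linarith | simp))+
      ultimately show "real m * \<theta> - 2 * pi \<le> pi + 2 * pi * of_int (j m)"
        "pi + 2 * pi * of_int (j m) \<le> real m * \<theta>" by (simp_all add: algebra_simps)
    qed
    show "(\<lambda>m. \<theta> - 2 * pi / real m) \<longlonglongrightarrow> \<theta>"
      using tendsto_diff[OF tendsto_const[of \<theta>] lim_const_over_n[of "2 * pi"]] by simp
    show "\<forall>\<^sub>F m in sequentially. \<theta> - 2 * pi / real m \<le> \<phi> m"
      using eventually_gt_at_top[of 0]
    proof eventually_elim
      case (elim m)
      then have "\<theta> - 2 * pi / real m = (real m * \<theta> - 2 * pi) / real m" by (simp add: field_simps)
      also have "\<dots> \<le> \<phi> m" unfolding \<phi>_def by (intro divide_right_mono bounds) simp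
      finally show ?case .
    qed
    show "\<forall>\<^sub>F m in sequentially. \<phi> m \<le> \<theta>"
      using eventually_gt_at_top[of 0]
    proof eventually_elim
      case (elim m)
      have "\<phi> m \<le> (real m * \<theta>) / real m" unfolding \<phi>_def by (intro divide_right_mono bounds) simp
      with elim show ?case by simp
    qed
  qed auto
  then have "w \<longlonglongrightarrow> rcis r \<theta>"
    unfolding w_def rcis_def cis_conv_exp by (intro tendsto_intros assms(2))
  ultimately show ?thesis by blast
qed

section \<open>Density of the connected set roots\<close>

text \<open>At \<open>z = w - 1\<close> the substituted value \<open>(1 + z)^m - 1\<close> is
  \<open>- t - 1\<close>, a root of the cycle polynomial.\<close>

lemma blowup_root_connected:
  fixes t :: real
  assumes "odd n" "m > 0" "t \<ge> 0" "(1 + t) ^ (n - 1) * (real n - 2 - t) = real n"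
    and "w ^ m = - complex_of_real t"
  shows "w - 1 \<in> {z. \<exists>G :: nat pair_pre_digraph. simple_graph G \<and>
    Digraph_Component.connected (with_proj G) \<and> poly (connected_set_poly G) z = 0}"
proof -
  have "n > 0" using assms(1) by (simp add: odd_pos)
  moreover have "simple_graph (cycle_blowup n m)"
    using \<open>n > 0\<close> assms(2) by (auto simp: simple_graph_def pair_graph_cycle_blowup lessThan_empty_iff)
  moreover have "poly (connected_set_poly (cycle_blowup n m)) (w - 1) = 0"
    using cycle_poly_root[OF assms(1,3,4)]
    by (simp add: poly_connected_set_poly_cycle_blowup[OF \<open>n > 0\<close>] assms(5))
  ultimately show ?thesis using connected_cycle_blowup assms(2) by blast
qed

theorem theorem12:
  shows "closure {z :: complex. \<exists>G :: nat pair_pre_digraph.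
           simple_graph G \<and> poly (connected_set_poly G) z = 0} = UNIV \<and>
         closure {z :: complex. \<exists>G :: nat pair_pre_digraph.
           simple_graph G \<and> Digraph_Component.connected (with_proj G) \<and>
           poly (connected_set_poly G) z = 0} = UNIV"
proof -
  let ?A = "{z :: complex. \<exists>G :: nat pair_pre_digraph. simple_graph G \<and>
    poly (connected_set_poly G) z = 0}"
  let ?B = "{z :: complex. \<exists>G :: nat pair_pre_digraph. simple_graph G \<and>
    Digraph_Component.connected (with_proj G) \<and> poly (connected_set_poly G) z = 0}"
  \<comment> \<open>The plane is covered by circles about -1; radii 0 and 1 are reached afterwards
    by a limit.\<close>
  have generic: "rcis r \<theta> - 1 \<in> closure ?B" if r: "r > 0" "r \<noteq> 1" for r \<theta>
  proof -
    obtain n t where nt: "\<And>m. odd (n m)" "\<And>m. (1 / 25) * r ^ m \<le> t m" "\<And>m. t m \<le> 5 * r ^ m"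
      "\<And>m. (1 + t m) ^ (n m - 1) * (real (n m) - 2 - t m) = real (n m)"
      using cycle_root_scaled[OF r] by metis
    have t: "t m \<ge> 0" for m
      using nt(2)[of m] r by (meson order_trans zero_le_power less_imp_le mult_nonneg_nonneg
          zero_le_divide_1_iff zero_le_numeral)
    have "(\<lambda>m. root m (t m)) \<longlonglongrightarrow> r"
      by (rule root_tendsto_if_scaled[OF _ _ r(1) nt(2,3)]) auto
    from negative_roots_tendsto[OF t this]
    obtain w where w: "\<And>m. m > 0 \<Longrightarrow> w m ^ m = - complex_of_real (t m)" "w \<longlonglongrightarrow> rcis r \<theta>"
      by blast
    \<comment> \<open>The shift discards \<open>m = 0\<close>, for which \<open>w\<close> is
      unconstrained.\<close>
    have "(\<lambda>m. w (Suc m) - 1) \<longlonglongrightarrow> rcis r \<theta> - 1"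
      using w(2) by (intro tendsto_diff tendsto_const) (simp add: LIMSEQ_Suc)
    moreover have "w (Suc m) - 1 \<in> ?B" for m
      by (rule blowup_root_connected[OF nt(1) _ t nt(4) w(1)]) auto
    ultimately show ?thesis
      unfolding closure_sequential by (intro exI[of _ "\<lambda>m. w (Suc m) - 1"]) simp
  qed
  have "z \<in> closure ?B" for z
  proof -
    define r where "r = norm (z + 1)"
    have z: "z = rcis r (Arg (z + 1)) - 1"
      by (simp add: r_def rcis_cmod_Arg)
    \<comment> \<open>Approaching \<open>z\<close> radially from outside keeps the radius positive
      for \<open>k > 0\<close>. It also avoids 1 eventually: it stays below 1 if
      \<open>r < 1\<close> and exceeds 1 otherwise.\<close>
    have "(\<lambda>k. r + 1 / real k) \<longlonglongrightarrow> r"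
      using tendsto_add[OF tendsto_const[of r] lim_1_over_n] by simp
    then have "(\<lambda>k. rcis (r + 1 / real k) (Arg (z + 1)) - 1) \<longlonglongrightarrow> rcis r (Arg (z + 1)) - 1"
      unfolding rcis_def by (intro tendsto_intros)
    then have "(\<lambda>k. rcis (r + 1 / real k) (Arg (z + 1)) - 1) \<longlonglongrightarrow> z"
      by (simp only: flip: z)
    moreover have "\<forall>\<^sub>F k in sequentially. rcis (r + 1 / real k) (Arg (z + 1)) - 1 \<in> closure ?B"
    proof -
      have "\<forall>\<^sub>F k in sequentially. r + 1 / real k \<noteq> 1"
      proof (cases "r < 1")
        case True
        then show ?thesis
          using \<open>(\<lambda>k. r + 1 / real k) \<longlonglongrightarrow> r\<close> by (auto dest!: order_tendstoD(2) elim: eventually_mono)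
      next
        case False
        show ?thesis using eventually_gt_at_top[of 0]
        proof eventually_elim
          case (elim k)
          then have "1 / real k > 0" by simp
          then show ?case using False by linarith
        qed
      qed
      then show ?thesis using eventually_gt_at_top[of 0]
      proof eventually_elim
        case (elim k)
        have "r \<ge> 0" by (simp add: r_def)
        then have "r + 1 / real k > 0" using elim by (simp add: add_nonneg_pos)
        then show ?case using generic elim by blast
      qed
    qed
    ultimately show ?thesis
      by (intro Lim_in_closed_set[OF closed_closure _ trivial_limit_sequentially])
  qed
  then have B: "closure ?B = UNIV" by blast
  moreover have "closure ?B \<subseteq> closure ?A" by (rule closure_mono) blast
  ultimately show ?thesis by blast
qed

end
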